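(* Let $\mathscr{M}=(\mathcal{C},\rho)$ be a semimatroid with a translative and cofinite action of a group $G$, and define $\rho_G:\mathcal{C}/G\to\mathbb{Z}_{\ge0}$ by $\rho_G(Gx)=\rho(x)$. Then $\mathscr{M}/G=(\mathcal{C}/G,\rho_G)$ is a matroid scheme with $F(\mathscr{M}/G)=F(\mathscr{M})/G$, $I(\mathscr{M}/G)=I(\mathscr{M})/G$, $C(\mathscr{M}/G)=C(\mathscr{M})/G$, and $T_{\mathscr{M}/G}(\mathrm{x},\mathrm{y})=T_{G\curvearrowright\mathscr{M}}(\mathrm{x},\mathrm{y})$.
   Context: A semimatroid is a pair $(\mathcal{C},\rho)$ with $\mathcal{C}$ a finite-dimensional simplicial complex (possibly with infinitely many vertices; its vertex set is $\mathrm{at}(\mathcal{C})$) and $\rho:\mathcal{C}\to\mathbb{Z}_{\ge0}$ such that: (S1) $0\le\rho(X)\le|X|$; (S2) $X\subseteq Y$ in $\mathcal{C}$ implies $\rho(X)\le\rho(Y)$; (S3) if $X,Y,X\cup Y\in\mathcal{C}$ then $\rho(X)+\rho(Y)\ge\rho(X\cup Y)+\rho(X\cap Y)$; (S4) if $X,Y\in\mathcal{C}$ and $\rho(X)=\rho(X\cap Y)$ then $X\cup Y\in\mathcal{C}$; (S5) if $X,Y\in\mathcal{C}$ and $\rho(X)<\rho(Y)$ then $X\cup\{y\}\in\mathcal{C}$ for some $y\in Y\setminus X$. Its rank $\rho(\mathscr{M})$ is the common value of $\rho$ on maximal simplices. An action of $G$ on $\mathscr{M}$ is an action on $\mathrm{at}(\mathcal{C})$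 such that for all $g$ and finite $A$, $A\in\mathcal{C}$ iff $gA\in\mathcal{C}$, and then $\rho(gA)=\rho(A)$. It is cofinite if there are finitely many orbits on $\mathrm{at}(\mathcal{C})$, and translative if $\{a,ga\}\in\mathcal{C}$ implies $ga=a$. For a poset $P$ with $G$-action, $P/G$ is the set of orbits with $Gx\le Gy$ iff $gx\le y$ for some $g\in G$. For a semimatroid (or matroid scheme): closure $\mathrm{cl}(x)$ is the unique maximal $y\ge x$ with $\rho(y)=\rho(x)$, flats are elements with $\mathrm{cl}(x)=x$, $F$ is the poset of flats; $I$ is the set of independent elements ($\rho(x)=|x|$); $C$ is the set of circuits (minimal elements $x$ with $\rho(x)<|x|$). Matroid scheme: pair $(S,\rho)$ with $S$ a finite simplicial poset (unique minimum, ranked, each $S_{\le x}$ Boolean on the atoms below $x$; $|x|$ the rank; $\bigvee T$/$\bigwedge T$ the sets of minimal upper/maximal lower bounds) satisfying (M1) $0\le\rho(x)\le|x|$; (M2) monotonicity; (M3) $u\in x\vee y\Rightarrow\rho(x)+\rho(y)\ge\rho(u)+\rho(x\wedge y)$; (M4) $\ell\in x\wedge y,\ \rho(x)=\rho(\ell)\Rightarrow x\vee y\ne\emptyset$; (M5) $\rho(x)<\rho(y)\Rightarrow$ some atom $a\le y$, $a\not\le x$, $x\vee a\ne\emptyset$. Its Tutte polynomial is $T_{\mathscr{M}}(\mathrm{x},\mathrm{y})=\sum_{w\in S}(\mathrm{x}-1)^{\rho(\mathscr{M})-\rho(w)}(\mathrm{y}-1)^{|w|-\rho(w)}$, where $\rho(\mathscr{M})$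 is $\rho$ of any maximal element. For $A\subseteq\mathrm{at}(\mathcal{C})/G$, $m_G(A)$ is the number of $G$-orbits on the set of simplices $\{a_1,\dots,a_k\}\in\mathcal{C}$ with $\{Ga_1,\dots,Ga_k\}=A$, and $\rho(A)$ denotes $\rho$ of such a simplex; $T_{G\curvearrowright\mathscr{M}}(\mathrm{x},\mathrm{y})=\sum_{A\subseteq\mathrm{at}(\mathcal{C})/G}m_G(A)(\mathrm{x}-1)^{\rho(\mathscr{M})-\rho(A)}(\mathrm{y}-1)^{|A|-\rho(A)}$.
   Formalization: The formal theorem additionally assumes that every m_G(A) is finite; without this, Z translating the complete bipartite graph on two copies of Z (ρ = cardinality) is translative and cofinite but has infinitely many simplex orbits. *)

theory Defs
  imports
    "HOL-Algebra.Group_Action"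
    "HOL-Computational_Algebra.Polynomial"
begin

text \<open>
  A poset is given by its reflexive order relation \<open>r :: 'b rel\<close>, as in
  \<^theory>\<open>HOL.Order_Relation\<close>: its underlying set is \<open>Field r\<close>, so equality of such relations is
  equality of posets (same elements, same order).  \<open>under r x\<close> is the lower set of \<open>x\<close>.
\<close>

definition minimals :: "'b rel \<Rightarrow> 'b set \<Rightarrow> 'b set"
  where "minimals r A = {x \<in> A. \<forall>y\<in>A. (y, x) \<in> r \<longrightarrow> y = x}"

definition maximals :: "'b rel \<Rightarrow> 'b set \<Rightarrow> 'b set"
  where "maximals r A = {x \<in> A. \<forall>y\<in>A. (x, y) \<in> r \<longrightarrow> y = x}"

definition joins :: "'b rel \<Rightarrow> 'b set \<Rightarrow> 'b set"
  where "joins r T = minimals r (Above r T)"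

definition meets :: "'b rel \<Rightarrow> 'b set \<Rightarrow> 'b set"
  where "meets r T = maximals r (Under r T)"

definition least_elem :: "'b rel \<Rightarrow> 'b"
  where "least_elem r = (THE b. b \<in> Field r \<and> (\<forall>x\<in>Field r. (b, x) \<in> r))"

definition atoms :: "'b rel \<Rightarrow> 'b set"
  where "atoms r = minimals r (Field r - {least_elem r})"

definition atoms_below :: "'b rel \<Rightarrow> 'b \<Rightarrow> 'b set"
  where "atoms_below r x = atoms r \<inter> under r x"

definition max_chains_below :: "'b rel \<Rightarrow> 'b \<Rightarrow> 'b set set"
  where "max_chains_below r x = {K. pred_on.maxchain (under r x) (\<lambda>a b. (a, b) \<in> r) K}"

text \<open>The rank of \<open>x\<close> is the length (one less than the cardinality) of any maximal chain below \<open>x\<close>.\<close>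

definition poset_rank :: "'b rel \<Rightarrow> 'b \<Rightarrow> nat"
  where "poset_rank r x = (THE n. \<forall>K\<in>max_chains_below r x. card K = Suc n)"

locale simplicial_poset =
  fixes r :: "'b rel"
  assumes partial_order: "Partial_order r"
    and minimum: "\<exists>b\<in>Field r. \<forall>x\<in>Field r. (b, x) \<in> r"
    and ranked: "\<And>x. x \<in> Field r \<Longrightarrow> \<exists>n. \<forall>K\<in>max_chains_below r x. card K = Suc n"
    and boolean_bij:
      "\<And>x. x \<in> Field r \<Longrightarrow> bij_betw (atoms_below r) (under r x) (Pow (atoms_below r x))"
    and boolean_order:
      "\<And>x y z. \<lbrakk>x \<in> Field r; y \<in> under r x; z \<in> under r x\<rbrakk>
        \<Longrightarrow> (y, z) \<in> r \<longleftrightarrow> atoms_below r y \<subseteq> atoms_below r z"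

text \<open>
  In (M3), existence of \<open>u \<in> x \<or> y\<close> forces \<open>x \<and> y\<close> to be a singleton (all lower bounds lie in the
  Boolean lattice below \<open>u\<close>); the quantifier over \<open>l\<close> ranges over this singleton.
\<close>

locale matroid_scheme = simplicial_poset r for r :: "'b rel" +
  fixes rho :: "'b \<Rightarrow> nat"
  assumes finite_carrier: "finite (Field r)"
    and M1: "\<And>x. x \<in> Field r \<Longrightarrow> rho x \<le> poset_rank r x"
    and M2: "\<And>x y. (x, y) \<in> r \<Longrightarrow> rho x \<le> rho y"
    and M3: "\<And>x y u l. \<lbrakk>x \<in> Field r; y \<in> Field r; u \<in> joins r {x, y}; l \<in> meets r {x, y}\<rbrakk>
      \<Longrightarrow> rho x + rho y \<ge> rho u + rho l"
    and M4: "\<And>x y l. \<lbrakk>x \<in> Field r; y \<in> Field r; l \<in> meets r {x, y}; rho x = rho l\<rbrakk>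
      \<Longrightarrow> joins r {x, y} \<noteq> {}"
    and M5: "\<And>x y. \<lbrakk>x \<in> Field r; y \<in> Field r; rho x < rho y\<rbrakk>
      \<Longrightarrow> \<exists>a\<in>atoms r. (a, y) \<in> r \<and> (a, x) \<notin> r \<and> joins r {x, a} \<noteq> {}"

locale semimatroid =
  fixes C :: "'a set set" and rho :: "'a set \<Rightarrow> nat"
  assumes empty_simplex: "{} \<in> C"
    and face_closed: "\<And>X Y. \<lbrakk>Y \<in> C; X \<subseteq> Y\<rbrakk> \<Longrightarrow> X \<in> C"
    and finite_dim: "\<exists>d. \<forall>X\<in>C. finite X \<and> card X \<le> d"
    and S1: "\<And>X. X \<in> C \<Longrightarrow> rho X \<le> card X"
    and S2: "\<And>X Y. \<lbrakk>X \<in> C; Y \<in> C; X \<subseteq> Y\<rbrakk> \<Longrightarrow> rho X \<le> rho Y"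
    and S3: "\<And>X Y. \<lbrakk>X \<in> C; Y \<in> C; X \<union> Y \<in> C\<rbrakk>
      \<Longrightarrow> rho X + rho Y \<ge> rho (X \<union> Y) + rho (X \<inter> Y)"
    and S4: "\<And>X Y. \<lbrakk>X \<in> C; Y \<in> C; rho X = rho (X \<inter> Y)\<rbrakk> \<Longrightarrow> X \<union> Y \<in> C"
    and S5: "\<And>X Y. \<lbrakk>X \<in> C; Y \<in> C; rho X < rho Y\<rbrakk> \<Longrightarrow> \<exists>y\<in>Y - X. insert y X \<in> C"

definition face_poset :: "'a set set \<Rightarrow> 'a set rel"
  where "face_poset C = {(X, Y). X \<in> C \<and> Y \<in> C \<and> X \<subseteq> Y}"

text \<open>
  The following notions are shared by semimatroids and matroid schemes.  The argument \<open>sz\<close> is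
  the function written \<open>|x|\<close>: \<open>card\<close> for a semimatroid, \<open>poset_rank r\<close> for a matroid scheme.
\<close>

definition total_rank :: "'b rel \<Rightarrow> ('b \<Rightarrow> nat) \<Rightarrow> nat"
  where "total_rank r rho = the_elem (rho ` maximals r (Field r))"

definition cl :: "'b rel \<Rightarrow> ('b \<Rightarrow> nat) \<Rightarrow> 'b \<Rightarrow> 'b"
  where "cl r rho x = (THE y. y \<in> maximals r {y. (x, y) \<in> r \<and> rho y = rho x})"

definition flats :: "'b rel \<Rightarrow> ('b \<Rightarrow> nat) \<Rightarrow> 'b set"
  where "flats r rho = {x \<in> Field r. cl r rho x = x}"

definition independents :: "'b rel \<Rightarrow> ('b \<Rightarrow> nat) \<Rightarrow> ('b \<Rightarrow> nat) \<Rightarrow> 'b set"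
  where "independents r sz rho = {x \<in> Field r. rho x = sz x}"

definition circuits :: "'b rel \<Rightarrow> ('b \<Rightarrow> nat) \<Rightarrow> ('b \<Rightarrow> nat) \<Rightarrow> 'b set"
  where "circuits r sz rho = minimals r {x \<in> Field r. rho x < sz x}"

locale semimatroid_action = semimatroid C rho + group_action G "\<Union>C" \<phi>
  for C :: "'a set set" and rho :: "'a set \<Rightarrow> nat"
    and G :: "('g, 'm) monoid_scheme" (structure) and \<phi> :: "'g \<Rightarrow> 'a \<Rightarrow> 'a" +
  assumes simplex_iff:
      "\<And>g A. \<lbrakk>g \<in> carrier G; finite A; A \<subseteq> \<Union>C\<rbrakk> \<Longrightarrow> A \<in> C \<longleftrightarrow> \<phi> g ` A \<in> C"
    and rho_invariant: "\<And>g A. \<lbrakk>g \<in> carrier G; A \<in> C\<rbrakk> \<Longrightarrow> rho (\<phi> g ` A) = rho A"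

definition cofinite_action :: "('g, 'm) monoid_scheme \<Rightarrow> ('g \<Rightarrow> 'a \<Rightarrow> 'a) \<Rightarrow> 'a set set \<Rightarrow> bool"
  where "cofinite_action G \<phi> C \<longleftrightarrow> finite (orbits G (\<Union>C) \<phi>)"

definition translative_action :: "('g, 'm) monoid_scheme \<Rightarrow> ('g \<Rightarrow> 'a \<Rightarrow> 'a) \<Rightarrow> 'a set set \<Rightarrow> bool"
  where "translative_action G \<phi> C \<longleftrightarrow>
    (\<forall>g\<in>carrier G. \<forall>a\<in>\<Union>C. {a, \<phi> g a} \<in> C \<longrightarrow> \<phi> g a = a)"

definition simplex_act :: "('g \<Rightarrow> 'a \<Rightarrow> 'a) \<Rightarrow> 'g \<Rightarrow> 'a set \<Rightarrow> 'a set"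
  where "simplex_act \<phi> g X = \<phi> g ` X"

definition quot_poset :: "('g, 'm) monoid_scheme \<Rightarrow> ('g \<Rightarrow> 'b \<Rightarrow> 'b) \<Rightarrow> 'b rel \<Rightarrow> 'b set rel"
  where "quot_poset G \<psi> r =
    {(orbit G \<psi> x, orbit G \<psi> y) | x y.
       x \<in> Field r \<and> y \<in> Field r \<and> (\<exists>g\<in>carrier G. (\<psi> g x, y) \<in> r)}"

text \<open>
  \<open>quot_rho rho (Gx) = rho x\<close>, see \<open>quot_rho_orbit\<close> below: an element of the quotient is an
  orbit, that is, a set of simplices on which \<open>rho\<close> is constant.
\<close>

definition quot_rho :: "('b \<Rightarrow> nat) \<Rightarrow> 'b set \<Rightarrow> nat"
  where "quot_rho rho O' = the_elem (rho ` O')"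

lemma (in semimatroid_action) quot_rho_orbit:
  assumes "X \<in> C"
  shows "quot_rho rho (orbit G (simplex_act \<phi>) X) = rho X"
proof -
  interpret group_hom G "BijGroup (\<Union>C)" \<phi> by (rule group_hom)
  have "rho Y = rho X" if "Y \<in> orbit G (simplex_act \<phi>) X" for Y
    using that rho_invariant[OF _ assms] by (auto simp: orbit_def simplex_act_def)
  moreover have "simplex_act \<phi> \<one> X \<in> orbit G (simplex_act \<phi>) X"
    using one_closed unfolding orbit_def by blast
  ultimately have "rho ` orbit G (simplex_act \<phi>) X = {rho X}"
    by (intro equalityI subsetI) (auto intro: rev_image_eqI)
  then show ?thesis by (simp add: quot_rho_def)
qed

text \<open>
  Bivariate integer polynomials are rendered as \<open>int poly poly\<close>, i.e. Z[x][y].  The exponents below are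
  differences of natural numbers that are nonnegative for the objects considered.
\<close>

definition varX :: "int poly poly" where "varX = [:[:0, 1:]:]"

definition varY :: "int poly poly" where "varY = [:0, 1:]"

definition tutte_scheme :: "'b rel \<Rightarrow> ('b \<Rightarrow> nat) \<Rightarrow> int poly poly"
  where "tutte_scheme r rho =
    (\<Sum>w\<in>Field r. (varX - 1) ^ (total_rank r rho - rho w) * (varY - 1) ^ (poset_rank r w - rho w))"

definition simplices_over ::
    "('g, 'm) monoid_scheme \<Rightarrow> ('g \<Rightarrow> 'a \<Rightarrow> 'a) \<Rightarrow> 'a set set \<Rightarrow> 'a set set \<Rightarrow> 'a set set"
  where "simplices_over G \<phi> C A = {X \<in> C. orbit G \<phi> ` X = A}"

definition orbits_over ::
    "('g, 'm) monoid_scheme \<Rightarrow> ('g \<Rightarrow> 'a \<Rightarrow> 'a) \<Rightarrow> 'a set set \<Rightarrow> 'a set set \<Rightarrow> 'a set set set"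
  where "orbits_over G \<phi> C A = orbits G (simplices_over G \<phi> C A) (simplex_act \<phi>)"

definition mult ::
    "('g, 'm) monoid_scheme \<Rightarrow> ('g \<Rightarrow> 'a \<Rightarrow> 'a) \<Rightarrow> 'a set set \<Rightarrow> 'a set set \<Rightarrow> nat"
  where "mult G \<phi> C A = card (orbits_over G \<phi> C A)"

text \<open>
  The common value of \<open>rho\<close> on the simplices over \<open>A\<close>.  It is unspecified if there are none; then
  \<open>mult G \<phi> C A = 0\<close>.
\<close>

definition rho_over ::
    "('g, 'm) monoid_scheme \<Rightarrow> ('g \<Rightarrow> 'a \<Rightarrow> 'a) \<Rightarrow> 'a set set \<Rightarrow> ('a set \<Rightarrow> nat) \<Rightarrow> 'a set set \<Rightarrow> nat"
  where "rho_over G \<phi> C rho A = the_elem (rho ` simplices_over G \<phi> C A)"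

definition tutte_action ::
    "('g, 'm) monoid_scheme \<Rightarrow> ('g \<Rightarrow> 'a \<Rightarrow> 'a) \<Rightarrow> 'a set set \<Rightarrow> ('a set \<Rightarrow> nat) \<Rightarrow> int poly poly"
  where "tutte_action G \<phi> C rho =
    (\<Sum>A\<in>Pow (orbits G (\<Union>C) \<phi>).
       of_nat (mult G \<phi> C A) * (varX - 1) ^ (total_rank (face_poset C) rho - rho_over G \<phi> C rho A)
         * (varY - 1) ^ (card A - rho_over G \<phi> C rho A))"

text \<open>
  Finitely many orbits of vertices do not imply finitely many orbits of simplices, even for
  translative actions: on the complete bipartite graph with parts Z and Z' (two copies of the
  integers), with \<open>rho = card\<close>, let the integers act by simultaneous translation.  There are two
  vertex orbits, but the edges \<open>{i, j'}\<close> fall into infinitely many orbits, indexed by \<open>i - j\<close>.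
  That each \<open>m_G(A)\<close> is a finite number is therefore a separate condition; together with
  cofiniteness it says exactly that there are finitely many orbits of simplices.
\<close>

definition finite_multiplicities ::
    "('g, 'm) monoid_scheme \<Rightarrow> ('g \<Rightarrow> 'a \<Rightarrow> 'a) \<Rightarrow> 'a set set \<Rightarrow> bool"
  where "finite_multiplicities G \<phi> C \<longleftrightarrow>
    (\<forall>A. A \<subseteq> orbits G (\<Union>C) \<phi> \<longrightarrow> finite (orbits_over G \<phi> C A))"

end

theory Submission
  imports Defs
begin

text \<open>
  By translativity, a group element that carries a face of a simplex \<open>X\<close> into \<open>X\<close> fixes every
  vertex of that face.  Hence distinct faces of \<open>X\<close> lie in distinct orbits, the lower set of \<open>GX\<close> in
  the quotient is a copy of the Boolean lattice of faces of \<open>X\<close>, and joins and meets in the quotient are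
  represented by unions and intersections of suitable representatives.  Each axiom of a matroid
  scheme then reduces to the corresponding axiom of the semimatroid, and closures, independent sets
  and circuits are computed on representatives.  For the Tutte polynomials, group the orbits of simplices by
  the set \<open>A\<close> of vertex orbits they meet; (S5) and translativity show that the rank depends only
  on \<open>A\<close>.
\<close>

section \<open>Posets\<close>

text \<open>Strict monotonicity makes \<open>h\<close> injective on a chain. If a maximal chain
  skipped a level \<open>i\<close>, an interpolated element of level \<open>i\<close> between its
  neighbours just below and just above the gap would be comparable with the whole chain. So a
  maximal chain meets each level from 0 to \<open>h x\<close> exactly once.\<close>

lemma card_maxchain_graded:
  fixes h :: "'b \<Rightarrow> nat"
  assumes r: "Partial_order r" and x: "x \<in> Field r"
    and strict: "\<And>a b. (a, b) \<in> r \<Longrightarrow> (b, x) \<in> r \<Longrightarrow> a \<noteq> b \<Longrightarrow> h a < h b"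
    and b0: "b0 \<in> under r x" "h b0 = 0" "\<And>y. y \<in> under r x \<Longrightarrow> (b0, y) \<in> r"
    and interpolate: "\<And>a b i. (a, b) \<in> r \<Longrightarrow> (b, x) \<in> r \<Longrightarrow> h a \<le> i \<Longrightarrow> i \<le> h b
      \<Longrightarrow> \<exists>c. (a, c) \<in> r \<and> (c, b) \<in> r \<and> h c = i"
    and K: "K \<in> max_chains_below r x"
  shows "card K = Suc (h x)"
proof -
  have refl: "(a, a) \<in> r" if "a \<in> Field r" for a
    using r that by (auto simp: order_on_defs refl_on_def)
  have trans: "(a, b) \<in> r \<Longrightarrow> (b, c) \<in> r \<Longrightarrow> (a, c) \<in> r" for a b c
    using r by (auto simp: order_on_defs dest: transD)
  have field: "a \<in> Field r" if "a \<in> under r x" for a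
    using that by (auto simp: under_def Field_def)
  have chain: "pred_on.chain (under r x) (\<lambda>a b. (a, b) \<in> r) K"
    using K by (simp add: max_chains_below_def pred_on.maxchain_def)
  then have sub: "K \<subseteq> under r x" by (simp add: pred_on.chain_def)
  have total: "(a, b) \<in> r \<or> (b, a) \<in> r" if "a \<in> K" "b \<in> K" for a b
    using chain that refl[of a] field[of a] sub unfolding pred_on.chain_def by blast
  have maxi: "c \<in> K" if c: "c \<in> under r x" and comp: "\<And>a. a \<in> K \<Longrightarrow> (a, c) \<in> r \<or> (c, a) \<in> r" for c
  proof (rule ccontr)
    assume "c \<notin> K"
    moreover have "pred_on.chain (under r x) (\<lambda>a b. (a, b) \<in> r) (insert c K)"
      using sub c total comp unfolding pred_on.chain_def by blast
    ultimately show False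
      using K unfolding max_chains_below_def pred_on.maxchain_def by blast
  qed
  have mono: "h a \<le> h b" if "(a, b) \<in> r" "(b, x) \<in> r" for a b
    using strict[OF that] by (cases "a = b") auto
  have less: "(a, b) \<in> r" if "a \<in> K" "b \<in> K" "h a < h b" for a b
    using total[OF that(1,2)] mono[of b a] that sub by (auto simp: under_def)
  have inj: "inj_on h K"
  proof (rule inj_onI)
    fix a b assume ab: "a \<in> K" "b \<in> K" "h a = h b"
    then have "(a, x) \<in> r" "(b, x) \<in> r" using sub by (auto simp: under_def)
    then show "a = b"
      using total[OF ab(1,2)] strict[of a b] strict[of b a] ab(3) by fastforce
  qed
  have "b0 \<in> K" using b0 sub by (intro maxi) auto
  have "x \<in> K" using refl[OF x] sub by (intro maxi) (auto simp: under_def)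
  have upper: "h a \<le> h x" if "a \<in> K" for a
    using mono[of a x] that sub refl[OF x] by (auto simp: under_def)
  have "i \<in> h ` K" if i: "i \<le> h x" for i
  proof (rule ccontr)
    assume miss: "i \<notin> h ` K"
    have fin: "finite (h ` K)"
      using upper by (auto intro: finite_subset[of _ "{..h x}"])
    \<comment> \<open>The levels of \<open>K\<close> on the two sides of the gap; \<open>b0\<close>
      and \<open>x\<close> show that neither side is empty.\<close>
    define L U where "L = {n \<in> h ` K. n < i}" and "U = {n \<in> h ` K. i < n}"
    have "0 \<in> h ` K" using \<open>b0 \<in> K\<close> b0(2) by (metis imageI)
    then have "0 \<in> L" unfolding L_def using miss by (metis (mono_tags, lifting) gr0I mem_Collect_eq)
    moreover have "finite L" using fin by (simp add: L_def)
    ultimately have "Max L \<in> L" by (intro Max_in) auto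
    then obtain a where a: "a \<in> K" "h a = Max L" "h a < i" by (auto simp: L_def)
    have "h x \<in> U" unfolding U_def using \<open>x \<in> K\<close> miss i
      by (metis (mono_tags, lifting) imageI le_neq_implies_less mem_Collect_eq)
    moreover have "finite U" using fin by (simp add: U_def)
    ultimately have "Min U \<in> U" by (intro Min_in) auto
    then obtain b where b: "b \<in> K" "h b = Min U" "i < h b" by (auto simp: U_def)
    have "(a, b) \<in> r" using less a b by simp
    moreover have "(b, x) \<in> r" using b(1) sub by (auto simp: under_def)
    ultimately obtain c where c: "(a, c) \<in> r" "(c, b) \<in> r" "h c = i"
      using interpolate[of a b i] a(3) b(3) by auto
    have "(d, c) \<in> r \<or> (c, d) \<in> r" if d: "d \<in> K" for d
    proof (cases "h d < i")
      case True
      then have "h d \<le> h a" using fin d a(2) by (auto simp: L_def)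
      then have "(d, a) \<in> r"
        using less[of d a] inj_onD[OF inj, of d a] d a(1) refl[of a] sub field
        by (metis le_neq_implies_less subsetD)
      then show ?thesis using trans c(1) by blast
    next
      case False
      then have "i < h d" using miss d by (metis imageI linorder_neqE_nat)
      then have "h b \<le> h d" using fin d b(2) by (auto simp: U_def)
      then have "(b, d) \<in> r"
        using less[of b d] inj_onD[OF inj, of b d] d b(1) refl[of b] sub field
        by (metis le_neq_implies_less subsetD)
      then show ?thesis using trans c(2) by blast
    qed
    moreover have "c \<in> under r x" using c(2) \<open>(b, x) \<in> r\<close> trans by (auto simp: under_def)
    ultimately have "c \<in> K" by (rule maxi[rotated])
    then show False using c(3) miss by blast
  qed
  then have "h ` K = {..h x}" using upper by auto
  then show ?thesis using card_image[OF inj] by simp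
qed

text \<open>The definite description has a unique solution only if some maximal chain exists; the
  Hausdorff maximal principle supplies one.\<close>

lemma poset_rank_eqI:
  assumes "\<And>K. K \<in> max_chains_below r x \<Longrightarrow> card K = Suc n"
  shows "poset_rank r x = n"
proof -
  obtain K where "K \<in> max_chains_below r x"
    unfolding max_chains_below_def using pred_on.Hausdorff by fastforce
  then show ?thesis
    unfolding poset_rank_def using assms by (intro the_equality) fastforce+
qed

text \<open>A greatest element of the same-rank set above \<open>x\<close> is its only maximal
  element, which resolves the definite description in \<open>cl\<close>.\<close>

lemma cl_eqI:
  assumes "Partial_order r" "(x, y) \<in> r" "rho y = rho x"
    and "\<And>z. (x, z) \<in> r \<Longrightarrow> rho z = rho x \<Longrightarrow> (z, y) \<in> r"
  shows "cl r rho x = y"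
proof -
  have "antisym r" using assms(1) by (simp add: order_on_defs)
  then show ?thesis
    unfolding cl_def maximals_def using assms(2-4)
    by (intro the_equality) (auto dest: antisymD)
qed

text \<open>In a finite poset the strict order is well founded, so a nonempty set of upper bounds
  has a minimal member. Through this lemma finiteness of the quotient enters (M4) and (M5).\<close>

lemma joins_nonempty:
  assumes r: "Partial_order r" and "finite (Field r)" and u: "u \<in> Above r T"
  shows "joins r T \<noteq> {}"
proof -
  have "wf (r - Id)"
  proof (rule finite_acyclic_wf)
    have "r \<subseteq> Field r \<times> Field r" by (auto simp: Field_def)
    then show "finite (r - Id)" using assms(2) by (meson finite_Diff finite_SigmaI finite_subset)
    show "acyclic (r - Id)"
      using r by (simp add: order_on_defs acyclic_irrefl trancl_id trans_diff_Id)
  qed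
  then obtain m where "m \<in> Above r T" "\<And>y. (y, m) \<in> r - Id \<Longrightarrow> y \<notin> Above r T"
    using u by (metis wfE_min)
  then show ?thesis unfolding joins_def minimals_def by blast
qed

section \<open>Orbits of simplices\<close>

context semimatroid_action
begin

sublocale group G
  using group_hom by (simp add: group_hom_def)

abbreviation orb :: "'a set \<Rightarrow> 'a set set"
  where "orb \<equiv> orbit G (simplex_act \<phi>)"

abbreviation P :: "'a set rel"
  where "P \<equiv> face_poset C"

abbreviation Q :: "'a set set rel"
  where "Q \<equiv> quot_poset G (simplex_act \<phi>) P"

lemma finite_simplex: "X \<in> C \<Longrightarrow> finite X"
  using finite_dim by blast

lemma in_vertices: "X \<in> C \<Longrightarrow> a \<in> X \<Longrightarrow> a \<in> \<Union>C"
  by blast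

lemma act_simplex: "g \<in> carrier G \<Longrightarrow> X \<in> C \<Longrightarrow> \<phi> g ` X \<in> C"
  using simplex_iff[of g X] finite_simplex by blast

lemma act_act:
  assumes "X \<in> C" "g \<in> carrier G" "h \<in> carrier G"
  shows "\<phi> g ` \<phi> h ` X = \<phi> (g \<otimes> h) ` X"
  using assms composition_rule[OF in_vertices] by (force simp: image_image)

lemma act_one: "X \<in> C \<Longrightarrow> \<phi> \<one> ` X = X"
  using id_eq_one in_vertices by (force simp flip: id_eq_one)

lemma act_inv: "X \<in> C \<Longrightarrow> g \<in> carrier G \<Longrightarrow> \<phi> (inv g) ` \<phi> g ` X = X"
  using act_act act_one by simp

lemma card_act: "X \<in> C \<Longrightarrow> g \<in> carrier G \<Longrightarrow> card (\<phi> g ` X) = card X"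
  by (intro card_image inj_on_subset[OF inj_prop]) auto

lemma orb_act:
  assumes "X \<in> C" "g \<in> carrier G"
  shows "orb (\<phi> g ` X) = orb X"
proof -
  have "\<phi> h ` X = \<phi> (h \<otimes> inv g) ` \<phi> g ` X" if "h \<in> carrier G" for h
    using act_act[OF act_simplex[OF assms(2,1)], of h "inv g"] act_inv[OF assms] assms that
    by simp
  moreover have "\<phi> h ` \<phi> g ` X = \<phi> (h \<otimes> g) ` X" if "h \<in> carrier G" for h
    using act_act assms that by simp
  ultimately show ?thesis
    unfolding orbit_def simplex_act_def using assms(2) m_closed inv_closed
    by (intro Collect_cong) metis
qed

lemma mem_orb: "X \<in> C \<Longrightarrow> X \<in> orb X"
  unfolding orbit_def simplex_act_def using act_one one_closed by force

lemma orb_eqE: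
  assumes "orb X = orb Y" "X \<in> C" "Y \<in> C"
  obtains g where "g \<in> carrier G" "Y = \<phi> g ` X"
proof -
  have "Y \<in> orb X" using mem_orb[OF assms(3)] assms(1) by simp
  then show ?thesis using that by (auto simp: orbit_def simplex_act_def)
qed

lemma card_orb_eq: "orb X = orb Y \<Longrightarrow> X \<in> C \<Longrightarrow> Y \<in> C \<Longrightarrow> card X = card Y"
  by (metis orb_eqE card_act)

lemma rho_orb_eq: "orb X = orb Y \<Longrightarrow> X \<in> C \<Longrightarrow> Y \<in> C \<Longrightarrow> rho X = rho Y"
  by (metis orb_eqE rho_invariant)

text \<open>The action preserves cardinality and simplices are finite, so no proper face of
  \<open>Y\<close> lies in the orbit of \<open>Y\<close>.\<close>

lemma subset_orb_eq: "X \<subseteq> Y \<Longrightarrow> orb X = orb Y \<Longrightarrow> Y \<in> C \<Longrightarrow> X = Y"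
  using card_orb_eq[of X Y] face_closed[of Y X] finite_simplex[of Y] card_subset_eq by blast

section \<open>The quotient of the face poset\<close>

lemma Field_P: "Field P = C"
  by (auto simp: face_poset_def Field_def)

lemma Partial_order_P: "Partial_order P"
  unfolding order_on_defs Field_P
  by (auto simp: face_poset_def refl_on_def intro!: transI antisymI)

lemma quot_iff:
  assumes "X \<in> C" "Y \<in> C"
  shows "(orb X, orb Y) \<in> Q \<longleftrightarrow> (\<exists>g\<in>carrier G. \<phi> g ` X \<subseteq> Y)"
proof
  assume "(orb X, orb Y) \<in> Q"
  then obtain X' Y' g where *: "orb X = orb X'" "orb Y = orb Y'" "X' \<in> C" "Y' \<in> C"
      "g \<in> carrier G" "\<phi> g ` X' \<subseteq> Y'"
    unfolding quot_poset_def Field_P by (auto simp: face_poset_def simplex_act_def)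
  \<comment> \<open>The definition of \<open>Q\<close> only provides some representatives
    \<open>X'\<close> and \<open>Y'\<close>; \<open>h\<close> and \<open>k\<close> transport the
    inclusion to the given ones.\<close>
  obtain h where h: "h \<in> carrier G" "X' = \<phi> h ` X" using orb_eqE * assms by metis
  obtain k where k: "k \<in> carrier G" "Y = \<phi> k ` Y'" using orb_eqE * assms by metis
  have "\<phi> k ` \<phi> g ` \<phi> h ` X \<subseteq> Y" using *(6) h k by (metis image_mono)
  moreover have "\<phi> k ` \<phi> g ` \<phi> h ` X = \<phi> (k \<otimes> (g \<otimes> h)) ` X"
    using act_act assms * h k by simp
  ultimately show "\<exists>g\<in>carrier G. \<phi> g ` X \<subseteq> Y" using * h k by auto
next
  assume "\<exists>g\<in>carrier G. \<phi> g ` X \<subseteq> Y"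
  then obtain g where "g \<in> carrier G" "(simplex_act \<phi> g X, Y) \<in> P"
    using assms act_simplex by (auto simp: face_poset_def simplex_act_def)
  then show "(orb X, orb Y) \<in> Q"
    unfolding quot_poset_def Field_P using assms by blast
qed

lemma quot_subset: "X \<subseteq> Y \<Longrightarrow> Y \<in> C \<Longrightarrow> (orb X, orb Y) \<in> Q"
  using quot_iff[of X Y] face_closed[of Y X] act_one[of X] one_closed by auto

lemma Field_Q: "Field Q = orb ` C"
proof
  show "Field Q \<subseteq> orb ` C" unfolding quot_poset_def Field_P by (auto simp: Field_def)
  show "orb ` C \<subseteq> Field Q" using quot_subset by (force simp: Field_def)
qed

text \<open>The lower representative can be translated into a fixed upper one. Together with the
  dual statement that follows, this turns relations in \<open>Q\<close> into inclusions of
  simplices.\<close>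

lemma quot_belowE:
  assumes "(x, orb Y) \<in> Q" "Y \<in> C"
  obtains X where "X \<in> C" "X \<subseteq> Y" "x = orb X"
proof -
  have "x \<in> Field Q" using assms(1) by (auto simp: Field_def)
  then obtain X where X: "X \<in> C" "x = orb X" by (auto simp: Field_Q)
  then obtain g where "g \<in> carrier G" "\<phi> g ` X \<subseteq> Y" using assms quot_iff by blast
  then show ?thesis using X that act_simplex orb_act by metis
qed

text \<open>Here \<open>X\<close> stays fixed and the upper simplex is pulled back by
  \<open>inv g\<close>.\<close>

lemma quot_aboveE:
  assumes "(orb X, y) \<in> Q" "X \<in> C"
  obtains Y where "Y \<in> C" "X \<subseteq> Y" "y = orb Y"
proof -
  have "y \<in> Field Q" using assms(1) by (auto simp: Field_def)
  then obtain Y where Y: "Y \<in> C" "y = orb Y" by (auto simp: Field_Q)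
  then obtain g where g: "g \<in> carrier G" "\<phi> g ` X \<subseteq> Y" using assms quot_iff by blast
  then have "\<phi> (inv g) ` \<phi> g ` X \<subseteq> \<phi> (inv g) ` Y" by blast
  then have "X \<subseteq> \<phi> (inv g) ` Y" using act_inv assms(2) g(1) by simp
  then show ?thesis using Y that act_simplex orb_act g(1) inv_closed by metis
qed

lemma Partial_order_Q: "Partial_order Q"
proof -
  have "refl_on (Field Q) Q"
    unfolding Field_Q refl_on_def using quot_subset Field_Q by (auto simp: Field_def)
  moreover have "trans Q"
  proof (rule transI)
    fix x y z assume xy: "(x, y) \<in> Q" and yz: "(y, z) \<in> Q"
    have "z \<in> Field Q" using yz by (auto simp: Field_def)
    then obtain Z where Z: "Z \<in> C" "z = orb Z" by (auto simp: Field_Q)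
    obtain Y where Y: "Y \<in> C" "Y \<subseteq> Z" "y = orb Y" using quot_belowE yz Z by metis
    obtain X where "X \<in> C" "X \<subseteq> Y" "x = orb X" using quot_belowE xy Y by metis
    then show "(x, z) \<in> Q" using quot_subset[of X Z] Y Z by auto
  qed
  moreover have "antisym Q"
  proof (rule antisymI)
    fix x y assume xy: "(x, y) \<in> Q" and yx: "(y, x) \<in> Q"
    have "y \<in> Field Q" using xy by (auto simp: Field_def)
    then obtain Y where Y: "Y \<in> C" "y = orb Y" by (auto simp: Field_Q)
    \<comment> \<open>Descending twice from \<open>Y\<close> gives
      \<open>Z \<subseteq> X \<subseteq> Y\<close> with \<open>Z\<close> and \<open>Y\<close> in one
      orbit; equal cardinality collapses the chain.\<close>
    obtain X where X: "X \<in> C" "X \<subseteq> Y" "x = orb X" using quot_belowE xy Y by metis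
    obtain Z where Z: "Z \<in> C" "Z \<subseteq> X" "y = orb Z" using quot_belowE yx X by metis
    have "Z = Y" using subset_orb_eq[of Z Y] X Y Z by auto
    then show "x = y" using X Y Z by auto
  qed
  moreover have "Q \<subseteq> Field Q \<times> Field Q" by (auto simp: Field_def)
  ultimately show ?thesis by (auto simp: order_on_defs)
qed

lemma quot_rho_orb: "X \<in> C \<Longrightarrow> quot_rho rho (orb X) = rho X"
  by (rule quot_rho_orbit)

section \<open>Least element and atoms of the quotient\<close>

lemma least_elem_Q: "least_elem Q = orb {}"
  unfolding least_elem_def
proof (rule the_equality)
  show least: "orb {} \<in> Field Q \<and> (\<forall>x\<in>Field Q. (orb {}, x) \<in> Q)"
    using empty_simplex quot_subset by (auto simp: Field_Q)
  fix b assume "b \<in> Field Q \<and> (\<forall>x\<in>Field Q. (b, x) \<in> Q)"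
  then show "b = orb {}"
    using least Partial_order_Q by (auto simp: order_on_defs dest: antisymD)
qed

lemma atoms_Q: "atoms Q = (\<lambda>a. orb {a}) ` \<Union>C"
proof (intro equalityI subsetI)
  fix x assume x: "x \<in> atoms Q"
  then obtain X where X: "X \<in> C" "x = orb X" "X \<noteq> {}"
    by (auto simp: atoms_def minimals_def Field_Q least_elem_Q)
  then obtain a where a: "a \<in> X" by blast
  have "{a} \<in> C" using face_closed[of X "{a}"] X a by auto
  moreover have "orb {a} \<noteq> orb {}" using subset_orb_eq[of "{}" "{a}"] \<open>{a} \<in> C\<close> by auto
  moreover have "(orb {a}, x) \<in> Q" using quot_subset[of "{a}" X] X a by auto
  ultimately have "orb {a} = x"
    using x by (auto simp: atoms_def minimals_def Field_Q least_elem_Q)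
  then show "x \<in> (\<lambda>a. orb {a}) ` \<Union>C" using X a by auto
next
  fix x assume "x \<in> (\<lambda>a. orb {a}) ` \<Union>C"
  then obtain a where x: "x = orb {a}" and a: "a \<in> \<Union>C" by auto
  have C: "{a} \<in> C" using a face_closed[of _ "{a}"] by blast
  have "orb {a} \<noteq> orb {}" using subset_orb_eq[of "{}" "{a}"] C by auto
  moreover have "y = x" if y: "(y, x) \<in> Q" "y \<noteq> orb {}" for y
  proof -
    obtain Y where "Y \<in> C" "Y \<subseteq> {a}" "y = orb Y" using quot_belowE y(1) C x by metis
    moreover have "Y \<noteq> {}" using y(2) \<open>y = orb Y\<close> by blast
    ultimately have "Y = {a}" by blast
    then show ?thesis using \<open>y = orb Y\<close> x by simp
  qed
  ultimately show "x \<in> atoms Q"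
    using C x by (auto simp: atoms_def minimals_def Field_Q least_elem_Q)
qed

section \<open>Vertex orbits and the fibres over sets of them\<close>

lemma vertex_orbit_act:
  assumes "a \<in> \<Union>C" "g \<in> carrier G"
  shows "orbit G \<phi> (\<phi> g a) = orbit G \<phi> a"
proof -
  have "\<phi> h a = \<phi> (h \<otimes> inv g) (\<phi> g a)" if "h \<in> carrier G" for h
  proof -
    have "\<phi> (h \<otimes> inv g) (\<phi> g a) = \<phi> h (\<phi> (inv g) (\<phi> g a))"
      using composition_rule[OF element_image[OF assms(2,1) refl]] assms(2) that by simp
    then show ?thesis using orbit_sym_aux[OF assms(2,1) refl] by simp
  qed
  moreover have "\<phi> h (\<phi> g a) = \<phi> (h \<otimes> g) a" if "h \<in> carrier G" for h
    using composition_rule assms that by simp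
  ultimately show ?thesis
    unfolding orbit_def using assms(2) m_closed inv_closed by (intro Collect_cong) metis
qed

lemma vertex_orbit_eqE:
  assumes "orbit G \<phi> a = orbit G \<phi> b" "b \<in> \<Union>C"
  obtains g where "g \<in> carrier G" "b = \<phi> g a"
proof -
  have "b \<in> orbit G \<phi> a" using orbit_refl[OF assms(2)] assms(1) by simp
  then show ?thesis using that by (auto simp: orbit_def)
qed

lemma vertex_orbits_eq:
  assumes "orb X = orb Y" "X \<in> C" "Y \<in> C"
  shows "orbit G \<phi> ` X = orbit G \<phi> ` Y"
proof -
  obtain g where g: "g \<in> carrier G" "Y = \<phi> g ` X" using orb_eqE assms by metis
  have "orbit G \<phi> (\<phi> g a) = orbit G \<phi> a" if "a \<in> X" for a
    using vertex_orbit_act[OF in_vertices] that assms(2) g(1) by simp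
  then show ?thesis using g(2) by (simp add: image_image)
qed

text \<open>Every simplex lies over the set of its vertex orbits, so the fibres exhaust the
  quotient. This covering yields the finiteness of \<open>Q\<close> and, together with disjointness,
  the regrouping of the Tutte sum.\<close>

lemma Field_Q_orbits_over:
  "Field Q = (\<Union>A\<in>Pow (orbits G (\<Union>C) \<phi>). orbits_over G \<phi> C A)"
proof -
  have over: "orb X \<in> orbits_over G \<phi> C (orbit G \<phi> ` X)"
    "orbit G \<phi> ` X \<in> Pow (orbits G (\<Union>C) \<phi>)" if "X \<in> C" for X
    using that by (auto simp: orbits_over_def simplices_over_def orbits_def)
  have "orbits_over G \<phi> C A \<subseteq> orb ` C" for A
    by (auto simp: orbits_over_def simplices_over_def orbits_def)
  moreover have "x \<in> (\<Union>A\<in>Pow (orbits G (\<Union>C) \<phi>). orbits_over G \<phi> C A)"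
    if "x \<in> orb ` C" for x
  proof -
    from that obtain X where "X \<in> C" "x = orb X" by (rule imageE)
    then show ?thesis using over[of X] by (metis UN_I)
  qed
  ultimately show ?thesis unfolding Field_Q by (intro equalityI subsetI UN_least) auto
qed

lemma orbits_over_disjoint:
  assumes "A \<noteq> B"
  shows "orbits_over G \<phi> C A \<inter> orbits_over G \<phi> C B = {}"
proof -
  have "A = B" if w: "w \<in> orbits_over G \<phi> C A" "w \<in> orbits_over G \<phi> C B" for w
  proof -
    obtain X where X: "X \<in> C" "orbit G \<phi> ` X = A" "w = orb X"
      using w(1) by (auto simp: orbits_over_def orbits_def simplices_over_def)
    obtain Y where Y: "Y \<in> C" "orbit G \<phi> ` Y = B" "w = orb Y"
      using w(2) by (auto simp: orbits_over_def orbits_def simplices_over_def)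
    show ?thesis using vertex_orbits_eq[of X Y] X Y by simp
  qed
  then show ?thesis using assms by blast
qed

text \<open>Cofiniteness bounds the number of fibres, and finite multiplicities make each fibre
  finite.\<close>

lemma finite_Field_Q:
  assumes "cofinite_action G \<phi> C" "finite_multiplicities G \<phi> C"
  shows "finite (Field Q)"
  unfolding Field_Q_orbits_over using assms
  by (auto simp: cofinite_action_def finite_multiplicities_def)

text \<open>Taking a subposet commutes with taking the quotient when \<open>S\<close> is a union of
  orbits: a relation in \<open>Q\<close> between orbits from \<open>S\<close> is witnessed by a
  translate of \<open>X\<close> inside \<open>Y\<close>, and invariance keeps this translate in
  \<open>S\<close>. The lemma is applied to flats, independent sets and circuits.\<close>

lemma quot_poset_Restr:
  assumes "S \<subseteq> C" and inv: "\<And>X Y. X \<in> S \<Longrightarrow> Y \<in> C \<Longrightarrow> orb X = orb Y \<Longrightarrow> Y \<in> S"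
  shows "quot_poset G (simplex_act \<phi>) (Restr P S) = Restr Q (orb ` S)"
proof -
  have field: "Field (Restr P S) = S"
    using assms(1) by (auto simp: Field_def face_poset_def)
  have act: "\<phi> g ` X \<in> S" if "X \<in> S" "g \<in> carrier G" for X g
    using that inv[of X "\<phi> g ` X"] orb_act act_simplex assms(1) by (metis subsetD)
  have PS: "(simplex_act \<phi> g X, Y) \<in> Restr P S \<longleftrightarrow> \<phi> g ` X \<subseteq> Y"
    if "X \<in> S" "Y \<in> S" "g \<in> carrier G" for X Y g
    using that act assms(1) by (auto simp: face_poset_def simplex_act_def)
  show ?thesis
  proof (intro equalityI subrelI)
    fix u v assume "(u, v) \<in> quot_poset G (simplex_act \<phi>) (Restr P S)"
    then obtain X Y g where "u = orb X" "v = orb Y" "X \<in> S" "Y \<in> S" "g \<in> carrier G" "\<phi> g ` X \<subseteq> Y"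
      unfolding quot_poset_def field using PS by blast
    then show "(u, v) \<in> Restr Q (orb ` S)" using quot_iff assms(1) by blast
  next
    fix u v assume "(u, v) \<in> Restr Q (orb ` S)"
    then obtain X Y where XY: "u = orb X" "v = orb Y" "X \<in> S" "Y \<in> S" "(orb X, orb Y) \<in> Q" by blast
    then obtain g where "g \<in> carrier G" "\<phi> g ` X \<subseteq> Y" using quot_iff assms(1) by blast
    then show "(u, v) \<in> quot_poset G (simplex_act \<phi>) (Restr P S)"
      unfolding quot_poset_def field using PS XY by blast
  qed
qed

lemma maximals_Q: "maximals Q (Field Q) = orb ` maximals P C"
proof (intro equalityI subsetI)
  fix x assume x: "x \<in> maximals Q (Field Q)"
  then obtain X where X: "X \<in> C" "x = orb X" by (auto simp: maximals_def Field_Q)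
  have "Y = X" if "Y \<in> C" "X \<subseteq> Y" for Y
  proof -
    have "orb Y = orb X"
      using x X that quot_subset[of X Y] by (auto simp: maximals_def Field_Q)
    then show ?thesis using subset_orb_eq[of X Y] that by auto
  qed
  then show "x \<in> orb ` maximals P C" using X by (auto simp: maximals_def face_poset_def)
next
  fix x assume "x \<in> orb ` maximals P C"
  then obtain X where X: "X \<in> C" "x = orb X" and max: "\<And>Y. Y \<in> C \<Longrightarrow> X \<subseteq> Y \<Longrightarrow> Y = X"
    by (auto simp: maximals_def face_poset_def)
  have "y = x" if xy: "(x, y) \<in> Q" for y
  proof -
    obtain Y where "Y \<in> C" "X \<subseteq> Y" "y = orb Y" using quot_aboveE xy X by metis
    then show ?thesis using max X by blast
  qed
  then show "x \<in> maximals Q (Field Q)" using X by (auto simp: maximals_def Field_Q)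
qed

text \<open>Both rank functions take the same set of values on maximal elements, so the two
  \<open>the_elem\<close> terms coincide.\<close>

lemma total_rank_Q: "total_rank Q (quot_rho rho) = total_rank P rho"
proof -
  have "quot_rho rho ` orb ` maximals P C = rho ` maximals P C"
    unfolding image_image by (intro image_cong refl) (simp add: maximals_def quot_rho_orb)
  then show ?thesis by (simp add: total_rank_def maximals_Q Field_P)
qed

section \<open>Closures and flats\<close>

lemma cl_P:
  assumes X: "X \<in> C"
  shows "cl P rho X \<in> C" "X \<subseteq> cl P rho X" "rho (cl P rho X) = rho X"
    and "\<And>Y. Y \<in> C \<Longrightarrow> X \<subseteq> Y \<Longrightarrow> rho Y = rho X \<Longrightarrow> Y \<subseteq> cl P rho X"
proof -
  \<comment> \<open>Finite dimension bounds the cardinalities in \<open>S\<close>, so a member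
    \<open>Z\<close> of largest size exists. It turns out to be the greatest member, hence the
    closure.\<close>
  define S where "S = {Y \<in> C. X \<subseteq> Y \<and> rho Y = rho X}"
  have "X \<in> S" using X by (simp add: S_def)
  moreover obtain d where "\<forall>Y. Y \<in> S \<longrightarrow> card Y < d"
    using finite_dim unfolding S_def by (metis (no_types, lifting) le_imp_less_Suc mem_Collect_eq)
  ultimately obtain Z where Z: "Z \<in> S" and max: "\<And>Y. Y \<in> S \<Longrightarrow> card Y \<le> card Z"
    using ex_has_greatest_nat[of "\<lambda>Y. Y \<in> S" X card d] by auto
  have greatest: "Y \<subseteq> Z" if Y: "Y \<in> S" for Y
  proof -
    have int: "Y \<inter> Z \<in> C" "X \<subseteq> Y \<inter> Z"
      using Y Z face_closed[of Y "Y \<inter> Z"] by (auto simp: S_def)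
    \<comment> \<open>Lying between \<open>X\<close> and \<open>Y\<close>, the intersection has the
      rank of \<open>X\<close>. Then (S4) makes the union a simplex and (S3) bounds its rank, so
      \<open>Y \<union> Z\<close> stays in \<open>S\<close> and the choice of \<open>Z\<close>
      absorbs \<open>Y\<close>.\<close>
    then have "rho X \<le> rho (Y \<inter> Z)" "rho (Y \<inter> Z) \<le> rho Y"
      using S2[of X "Y \<inter> Z"] S2[of "Y \<inter> Z" Y] X Y by (auto simp: S_def)
    then have rho: "rho (Y \<inter> Z) = rho X" using Y by (simp add: S_def)
    then have un: "Y \<union> Z \<in> C" using S4[of Y Z] Y Z by (simp add: S_def)
    then have "rho (Y \<union> Z) \<le> rho X" using S3[of Y Z] rho Y Z by (simp add: S_def)
    moreover have "rho X \<le> rho (Y \<union> Z)" using S2[of X "Y \<union> Z"] X un Y by (auto simp: S_def)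
    ultimately have "Y \<union> Z \<in> S" using un Y by (auto simp: S_def)
    then have "Z = Y \<union> Z"
      using max finite_simplex[OF un] by (intro card_seteq) auto
    then show ?thesis by blast
  qed
  have "cl P rho X = Z"
    using Z greatest X by (intro cl_eqI Partial_order_P) (auto simp: S_def face_poset_def)
  then show "cl P rho X \<in> C" "X \<subseteq> cl P rho X" "rho (cl P rho X) = rho X"
    and "\<And>Y. Y \<in> C \<Longrightarrow> X \<subseteq> Y \<Longrightarrow> rho Y = rho X \<Longrightarrow> Y \<subseteq> cl P rho X"
    using Z greatest by (auto simp: S_def)
qed

text \<open>Every competitor above \<open>orb X\<close> has a representative containing
  \<open>X\<close>, so the universal property of the closure in \<open>C\<close> passes to the
  quotient.\<close>

lemma cl_Q:
  assumes X: "X \<in> C"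
  shows "cl Q (quot_rho rho) (orb X) = orb (cl P rho X)"
proof (rule cl_eqI[OF Partial_order_Q])
  show "(orb X, orb (cl P rho X)) \<in> Q" using quot_subset cl_P X by simp
  show "quot_rho rho (orb (cl P rho X)) = quot_rho rho (orb X)"
    using quot_rho_orb cl_P X by simp
  fix z assume z: "(orb X, z) \<in> Q" "quot_rho rho z = quot_rho rho (orb X)"
  then obtain Z where "Z \<in> C" "X \<subseteq> Z" "z = orb Z" using quot_aboveE X by metis
  then show "(z, orb (cl P rho X)) \<in> Q" using z(2) cl_P[OF X] quot_subset quot_rho_orb X by simp
qed

text \<open>\<open>X\<close> is a face of its closure, so the two are equal as soon as they share an
  orbit. This gives the correspondence of flats.\<close>

lemma cl_Q_eq_iff: "X \<in> C \<Longrightarrow> cl Q (quot_rho rho) (orb X) = orb X \<longleftrightarrow> cl P rho X = X"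
  using cl_Q[of X] cl_P[of X] subset_orb_eq[of X "cl P rho X"] by auto

lemma flats_quotient:
  "Restr Q (flats Q (quot_rho rho)) = quot_poset G (simplex_act \<phi>) (Restr P (flats P rho))"
proof -
  have "flats Q (quot_rho rho) = orb ` flats P rho"
    using cl_Q_eq_iff by (auto simp: flats_def Field_Q Field_P)
  moreover have "quot_poset G (simplex_act \<phi>) (Restr P (flats P rho)) = Restr Q (orb ` flats P rho)"
  proof (rule quot_poset_Restr)
    show "flats P rho \<subseteq> C" by (auto simp: flats_def Field_P)
    show "Y \<in> flats P rho" if "X \<in> flats P rho" "Y \<in> C" "orb X = orb Y" for X Y
      using that cl_Q_eq_iff[of X] cl_Q_eq_iff[of Y] by (simp add: flats_def Field_P)
  qed
  ultimately show ?thesis by simp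
qed

end

section \<open>Translative actions\<close>

locale translative_semimatroid_action = semimatroid_action +
  assumes translative: "translative_action G \<phi> C"
begin

text \<open>The pair \<open>{a, \<phi> g a}\<close> is a face of \<open>Z\<close>. Translativity
  enters all later arguments in this form.\<close>

lemma vertex_fixed:
  assumes "Z \<in> C" "a \<in> Z" "\<phi> g a \<in> Z" "g \<in> carrier G"
  shows "\<phi> g a = a"
  using assms face_closed[of Z "{a, \<phi> g a}"] translative
  unfolding translative_action_def by blast

text \<open>A group element carrying \<open>X\<close> into \<open>Y\<close> moves vertices of
  \<open>Z\<close> to vertices of \<open>Z\<close>, so it fixes \<open>X\<close> pointwise. Hence
  the order below \<open>orb Z\<close> is inclusion of faces.\<close>

lemma quot_le_iff:
  assumes Z: "Z \<in> C" "X \<subseteq> Z" "Y \<subseteq> Z"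
  shows "(orb X, orb Y) \<in> Q \<longleftrightarrow> X \<subseteq> Y"
proof
  assume "(orb X, orb Y) \<in> Q"
  then obtain g where g: "g \<in> carrier G" "\<phi> g ` X \<subseteq> Y"
    using quot_iff Z face_closed by metis
  have "\<phi> g a = a" if "a \<in> X" for a
    using that g Z by (intro vertex_fixed[of Z]) auto
  then show "X \<subseteq> Y" using g(2) by force
next
  show "X \<subseteq> Y \<Longrightarrow> (orb X, orb Y) \<in> Q"
    using quot_subset Z face_closed by metis
qed

lemma quot_eq_iff:
  assumes Z: "Z \<in> C" "X \<subseteq> Z" "Y \<subseteq> Z"
  shows "orb X = orb Y \<longleftrightarrow> X = Y"
proof
  assume eq: "orb X = orb Y"
  have "(orb X, orb X) \<in> Q" using quot_le_iff[OF Z(1,2,2)] by blast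
  then have "(orb X, orb Y) \<in> Q" "(orb Y, orb X) \<in> Q" using eq by metis+
  then show "X = Y" using quot_le_iff[OF Z] quot_le_iff[OF Z(1,3,2)] by blast
qed simp

lemma under_Q: "X \<in> C \<Longrightarrow> under Q (orb X) = orb ` Pow X"
  using quot_belowE[of _ X] quot_subset[of _ X] by (auto simp: under_def)

section \<open>Atoms, ranks and Boolean lower sets\<close>

lemma atoms_below_Q:
  assumes X: "X \<in> C"
  shows "atoms_below Q (orb X) = (\<lambda>a. orb {a}) ` X"
proof (intro equalityI subsetI)
  fix x assume "x \<in> atoms_below Q (orb X)"
  then obtain a Y where *: "a \<in> \<Union>C" "x = orb {a}" "Y \<subseteq> X" "x = orb Y"
    unfolding atoms_below_def atoms_Q under_Q[OF X] by blast
  \<comment> \<open>The vertex \<open>a\<close> itself may lie outside \<open>X\<close>, but the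
    representative \<open>Y\<close> inside \<open>X\<close> has the same cardinality.\<close>
  have "{a} \<in> C" "Y \<in> C" using * X face_closed[of _ "{a}"] face_closed[of X Y] by auto
  then have "card Y = 1" using card_orb_eq[of "{a}" Y] * by simp
  then show "x \<in> (\<lambda>a. orb {a}) ` X" using * by (auto simp: card_1_singleton_iff)
next
  fix x assume "x \<in> (\<lambda>a. orb {a}) ` X"
  then show "x \<in> atoms_below Q (orb X)"
    using X by (auto simp: atoms_below_def atoms_Q under_Q[OF X])
qed

lemma inj_on_singleton_orb:
  assumes "X \<in> C"
  shows "inj_on (\<lambda>a. orb {a}) X"
  using quot_eq_iff[OF assms] by (intro inj_onI) (metis empty_subsetI insert_subset singleton_inject)

text \<open>A level function on \<open>Q\<close>, independent of the chosen representative because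
  the action preserves cardinality. It serves to compute \<open>poset_rank\<close>.\<close>

definition size_Q :: "'a set set \<Rightarrow> nat"
  where "size_Q x = card (SOME X. X \<in> C \<and> x = orb X)"

lemma size_Q_orb: "X \<in> C \<Longrightarrow> size_Q (orb X) = card X"
  unfolding size_Q_def by (rule someI2[of _ X]) (auto dest: card_orb_eq)

lemma card_maxchain_Q:
  assumes X: "X \<in> C" and K: "K \<in> max_chains_below Q (orb X)"
  shows "card K = Suc (card X)"
proof -
  have "card K = Suc (size_Q (orb X))"
  proof (rule card_maxchain_graded[OF Partial_order_Q _ _ _ _ _ _ K])
    show "orb X \<in> Field Q" using X by (simp add: Field_Q)
    show "size_Q a < size_Q b" if ab: "(a, b) \<in> Q" "(b, orb X) \<in> Q" "a \<noteq> b" for a b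
    proof -
      obtain B where B: "B \<in> C" "B \<subseteq> X" "b = orb B" using quot_belowE ab(2) X by metis
      obtain A where A: "A \<in> C" "A \<subseteq> B" "a = orb A" using quot_belowE ab(1) B by metis
      have "A \<subset> B" using A B ab(3) by blast
      then show ?thesis
        using psubset_card_mono[OF finite_simplex[OF B(1)]] A B by (simp add: size_Q_orb)
    qed
    show "orb {} \<in> under Q (orb X)" using under_Q[OF X] by blast
    show "size_Q (orb {}) = 0" using size_Q_orb empty_simplex by simp
    show "(orb {}, y) \<in> Q" if "y \<in> under Q (orb X)" for y
      using that quot_subset X face_closed[of X] by (auto simp: under_Q)
    show "\<exists>c. (a, c) \<in> Q \<and> (c, b) \<in> Q \<and> size_Q c = i"
      if ab: "(a, b) \<in> Q" "(b, orb X) \<in> Q" "size_Q a \<le> i" "i \<le> size_Q b" for a b i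
    proof -
      obtain B where B: "B \<in> C" "B \<subseteq> X" "b = orb B" using quot_belowE ab(2) X by metis
      obtain A where A: "A \<in> C" "A \<subseteq> B" "a = orb A" using quot_belowE ab(1) B by metis
      \<comment> \<open>Interpolating between levels means choosing a set of prescribed size between
        two faces.\<close>
      obtain D where D: "A \<subseteq> D" "D \<subseteq> B" "card D = i"
        using exists_subset_between[of A i B] finite_simplex A B ab(3,4) by (auto simp: size_Q_orb)
      have "D \<in> C" using D B face_closed by metis
      then show ?thesis using A B D quot_subset size_Q_orb by metis
    qed
  qed
  then show ?thesis using size_Q_orb X by simp
qed

lemma poset_rank_Q: "X \<in> C \<Longrightarrow> poset_rank Q (orb X) = card X"
  using card_maxchain_Q by (intro poset_rank_eqI)

text \<open>For faces \<open>Y\<close> of \<open>X\<close>, passing from \<open>orb Y\<close> to its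
  atoms is taking the image of \<open>Y\<close> under an injection on the vertices of
  \<open>X\<close>. Both Boolean axioms thereby reduce to facts about \<open>Pow X\<close>.\<close>

lemma simplicial_poset_Q: "simplicial_poset Q"
proof
  show "Partial_order Q" by (rule Partial_order_Q)
  show "\<exists>b\<in>Field Q. \<forall>x\<in>Field Q. (b, x) \<in> Q"
    using quot_subset[of "{}"] empty_simplex by (auto simp: Field_Q)
  fix x assume "x \<in> Field Q"
  then obtain X where X: "X \<in> C" "x = orb X" by (auto simp: Field_Q)
  show "\<exists>n. \<forall>K\<in>max_chains_below Q x. card K = Suc n"
    using card_maxchain_Q X by blast
  have below: "atoms_below Q (orb Y) = (\<lambda>a. orb {a}) ` Y" if "Y \<subseteq> X" for Y
    using atoms_below_Q[of Y] face_closed[of X Y] X that by simp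
  note inj = inj_on_singleton_orb[OF X(1)]
  show "bij_betw (atoms_below Q) (under Q x) (Pow (atoms_below Q x))"
    unfolding bij_betw_def
  proof
    show "inj_on (atoms_below Q) (under Q x)"
      using inj by (auto simp: X under_Q below inj_on_image_eq_iff intro!: inj_onI)
    show "atoms_below Q ` under Q x = Pow (atoms_below Q x)"
      unfolding X(2) under_Q[OF X(1)] atoms_below_Q[OF X(1)] image_Pow_surj[OF refl, symmetric] image_image
      using below by (intro image_cong) auto
  qed
  show "(y, z) \<in> Q \<longleftrightarrow> atoms_below Q y \<subseteq> atoms_below Q z"
    if yz: "y \<in> under Q x" "z \<in> under Q x" for y z
  proof -
    obtain Y Z where YZ: "Y \<subseteq> X" "Z \<subseteq> X" and "y = orb Y" "z = orb Z"
      using yz unfolding X(2) under_Q[OF X(1)] by blast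
    moreover have "(\<lambda>a. orb {a}) ` Y \<subseteq> (\<lambda>a. orb {a}) ` Z \<longleftrightarrow> Y \<subseteq> Z"
      using inj_on_image_mem_iff[OF inj _ YZ(2)] YZ(1) by blast
    ultimately show ?thesis using quot_le_iff[OF X(1) YZ] below YZ by simp
  qed
qed

section \<open>The axioms of a matroid scheme\<close>

lemma matroid_scheme_Q:
  assumes fin: "finite (Field Q)"
  shows "matroid_scheme Q (quot_rho rho)"
proof (intro matroid_scheme.intro simplicial_poset_Q matroid_scheme_axioms.intro)
  show "finite (Field Q)" by (rule fin)
  show "quot_rho rho x \<le> poset_rank Q x" if "x \<in> Field Q" for x
    using that S1 quot_rho_orb poset_rank_Q by (auto simp: Field_Q)
  show "quot_rho rho x \<le> quot_rho rho y" if xy: "(x, y) \<in> Q" for x y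
  proof -
    have "y \<in> Field Q" using xy by (auto simp: Field_def)
    then obtain Y where Y: "Y \<in> C" "y = orb Y" by (auto simp: Field_Q)
    obtain X where "X \<in> C" "X \<subseteq> Y" "x = orb X" using quot_belowE xy Y by metis
    then show ?thesis using Y S2 quot_rho_orb by simp
  qed
  show "quot_rho rho u + quot_rho rho l \<le> quot_rho rho x + quot_rho rho y"
    if xyul: "x \<in> Field Q" "y \<in> Field Q" "u \<in> joins Q {x, y}" "l \<in> meets Q {x, y}" for x y u l
  proof -
    have "u \<in> Field Q" "(x, u) \<in> Q" "(y, u) \<in> Q"
      using xyul(3) by (auto simp: joins_def minimals_def Above_def)
    \<comment> \<open>For (M3), a representative of the join is fixed first, so that
      \<open>X\<close> and \<open>Y\<close> become faces of one simplex. Their union is then a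
      simplex inside \<open>U\<close>, and minimality of \<open>u\<close> identifies
      \<open>u\<close> with its orbit.\<close>
    then obtain U where U: "U \<in> C" "u = orb U" by (auto simp: Field_Q)
    obtain X where X: "X \<in> C" "X \<subseteq> U" "x = orb X" using quot_belowE \<open>(x, u) \<in> Q\<close> U by metis
    obtain Y where Y: "Y \<in> C" "Y \<subseteq> U" "y = orb Y" using quot_belowE \<open>(y, u) \<in> Q\<close> U by metis
    have un: "X \<union> Y \<in> C" using face_closed[of U "X \<union> Y"] U X Y by simp
    have "(x, orb (X \<union> Y)) \<in> Q" "(y, orb (X \<union> Y)) \<in> Q" "(orb (X \<union> Y), u) \<in> Q"
      using quot_subset un U X Y by simp_all
    then have u: "u = orb (X \<union> Y)"
      using xyul(3) un by (auto simp: joins_def minimals_def Above_def Field_Q)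
    have "(l, x) \<in> Q" "(l, y) \<in> Q" using xyul(4) by (auto simp: meets_def maximals_def Under_def)
    obtain L where L: "L \<in> C" "L \<subseteq> X" "l = orb L" using quot_belowE \<open>(l, x) \<in> Q\<close> X by metis
    \<comment> \<open>\<open>L\<close> was chosen inside \<open>X\<close>; comparing faces within
      \<open>U\<close> puts it inside \<open>Y\<close> as well. Maximality of \<open>l\<close> then
      identifies it with the orbit of \<open>X \<inter> Y\<close>.\<close>
    have "L \<subseteq> Y" using quot_le_iff[of U L Y] \<open>(l, y) \<in> Q\<close> U X Y L by auto
    have int: "X \<inter> Y \<in> C" using face_closed[of X "X \<inter> Y"] X by simp
    have "(orb (X \<inter> Y), x) \<in> Q" "(orb (X \<inter> Y), y) \<in> Q" "(l, orb (X \<inter> Y)) \<in> Q"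
      using quot_subset int X Y L \<open>L \<subseteq> Y\<close> by simp_all
    then have l: "l = orb (X \<inter> Y)"
      using xyul(4) int by (auto simp: meets_def maximals_def Under_def Field_Q)
    show ?thesis using S3[of X Y] un int X Y u l by (simp add: quot_rho_orb)
  qed
  show "joins Q {x, y} \<noteq> {}"
    if xyl: "x \<in> Field Q" "y \<in> Field Q" "l \<in> meets Q {x, y}" "quot_rho rho x = quot_rho rho l"
    for x y l
  proof -
    have lxy: "l \<in> Field Q" "(l, x) \<in> Q" "(l, y) \<in> Q"
      using xyl(3) by (auto simp: meets_def maximals_def Under_def)
    \<comment> \<open>For (M4) no upper bound is available yet, so \<open>X\<close> and
      \<open>Y\<close> are built upwards from a common \<open>L\<close>. Maximality of
      \<open>l\<close> again gives the orbit of \<open>X \<inter> Y\<close>, and (S4) supplies the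
      union.\<close>
    then obtain L where L: "L \<in> C" "l = orb L" by (auto simp: Field_Q)
    obtain X where X: "X \<in> C" "L \<subseteq> X" "x = orb X" using quot_aboveE lxy(2) L by metis
    obtain Y where Y: "Y \<in> C" "L \<subseteq> Y" "y = orb Y" using quot_aboveE lxy(3) L by metis
    have int: "X \<inter> Y \<in> C" using face_closed[of X "X \<inter> Y"] X by simp
    have "(orb (X \<inter> Y), x) \<in> Q" "(orb (X \<inter> Y), y) \<in> Q" "(l, orb (X \<inter> Y)) \<in> Q"
      using quot_subset int X Y L by simp_all
    then have "l = orb (X \<inter> Y)"
      using xyl(3) int by (auto simp: meets_def maximals_def Under_def Field_Q)
    then have un: "X \<union> Y \<in> C" using S4[of X Y] X Y int xyl(4) by (simp add: quot_rho_orb)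
    then have "orb (X \<union> Y) \<in> Above Q {x, y}"
      using quot_subset X Y by (simp add: Above_def Field_Q)
    then show ?thesis by (rule joins_nonempty[OF Partial_order_Q fin])
  qed
  show "\<exists>a\<in>atoms Q. (a, y) \<in> Q \<and> (a, x) \<notin> Q \<and> joins Q {x, a} \<noteq> {}"
    if xy: "x \<in> Field Q" "y \<in> Field Q" "quot_rho rho x < quot_rho rho y" for x y
  proof -
    obtain X Y where X: "X \<in> C" "x = orb X" and Y: "Y \<in> C" "y = orb Y"
      using xy by (auto simp: Field_Q)
    then obtain a where a: "a \<in> Y" "a \<notin> X" "insert a X \<in> C"
      using S5[of X Y] xy(3) by (auto simp: quot_rho_orb)
    have "orb {a} \<in> atoms Q" using a Y by (auto simp: atoms_Q)
    moreover have "(orb {a}, y) \<in> Q" using quot_subset a Y by simp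
    \<comment> \<open>Inside the simplex \<open>insert a X\<close> the order is inclusion, so no
      translate of \<open>a\<close> lies in \<open>X\<close>.\<close>
    moreover have "(orb {a}, x) \<notin> Q" using quot_le_iff[of "insert a X" "{a}" X] a X by auto
    moreover have "orb (insert a X) \<in> Above Q {x, orb {a}}"
      using quot_subset[of _ "insert a X"] a X by (auto simp: Above_def Field_Q)
    then have "joins Q {x, orb {a}} \<noteq> {}" by (rule joins_nonempty[OF Partial_order_Q fin])
    ultimately show ?thesis by blast
  qed
qed

section \<open>Independent sets and circuits\<close>

lemma independents_quotient:
  "Restr Q (independents Q (poset_rank Q) (quot_rho rho)) =
    quot_poset G (simplex_act \<phi>) (Restr P (independents P card rho))"
proof -
  have "independents Q (poset_rank Q) (quot_rho rho) = orb ` independents P card rho"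
    using poset_rank_Q quot_rho_orb by (auto simp: independents_def Field_Q Field_P)
  moreover have "quot_poset G (simplex_act \<phi>) (Restr P (independents P card rho)) =
      Restr Q (orb ` independents P card rho)"
  proof (rule quot_poset_Restr)
    show "independents P card rho \<subseteq> C" by (auto simp: independents_def Field_P)
    show "Y \<in> independents P card rho"
      if "X \<in> independents P card rho" "Y \<in> C" "orb X = orb Y" for X Y
      using that rho_orb_eq[of X Y] card_orb_eq[of X Y] by (simp add: independents_def Field_P)
  qed
  ultimately show ?thesis by simp
qed

text \<open>A dependent element below \<open>orb X\<close> is represented by a face of
  \<open>X\<close>, itself dependent because rank and cardinality are constant on orbits. Minimality
  in \<open>Q\<close> is therefore tested on the faces of \<open>X\<close>.\<close>

lemma orb_circuit_iff:
  assumes X: "X \<in> C"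
  shows "orb X \<in> circuits Q (poset_rank Q) (quot_rho rho) \<longleftrightarrow> X \<in> circuits P card rho"
proof -
  have "orb X \<in> circuits Q (poset_rank Q) (quot_rho rho) \<longleftrightarrow>
      rho X < card X \<and> (\<forall>Y\<in>C. rho Y < card Y \<longrightarrow> (orb Y, orb X) \<in> Q \<longrightarrow> orb Y = orb X)"
    using X by (auto simp: circuits_def minimals_def Field_Q poset_rank_Q quot_rho_orb)
  also have "\<dots> \<longleftrightarrow> rho X < card X \<and> (\<forall>Y\<in>C. rho Y < card Y \<longrightarrow> Y \<subseteq> X \<longrightarrow> Y = X)"
  proof (intro conj_cong refl iffI ballI impI)
    fix Y assume "\<forall>Y\<in>C. rho Y < card Y \<longrightarrow> (orb Y, orb X) \<in> Q \<longrightarrow> orb Y = orb X"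
      and Y: "Y \<in> C" "rho Y < card Y" "Y \<subseteq> X"
    then have "orb Y = orb X" using quot_subset X by blast
    then show "Y = X" using subset_orb_eq X Y by metis
  next
    fix Y assume min: "\<forall>Y\<in>C. rho Y < card Y \<longrightarrow> Y \<subseteq> X \<longrightarrow> Y = X"
      and Y: "Y \<in> C" "rho Y < card Y" "(orb Y, orb X) \<in> Q"
    obtain Z where Z: "Z \<in> C" "Z \<subseteq> X" "orb Y = orb Z" using quot_belowE Y(3) X by metis
    then have "rho Z < card Z" using Y rho_orb_eq[of Y Z] card_orb_eq[of Y Z] by simp
    then show "orb Y = orb X" using min Z by blast
  qed
  also have "\<dots> \<longleftrightarrow> X \<in> circuits P card rho"
    using X by (auto simp: circuits_def minimals_def Field_P) (auto simp: face_poset_def)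
  finally show ?thesis .
qed

lemma circuits_quotient:
  "Restr Q (circuits Q (poset_rank Q) (quot_rho rho)) =
    quot_poset G (simplex_act \<phi>) (Restr P (circuits P card rho))"
proof -
  have sub: "circuits P card rho \<subseteq> C" by (auto simp: circuits_def minimals_def Field_P)
  have "circuits Q (poset_rank Q) (quot_rho rho) \<subseteq> orb ` C"
    by (auto simp: circuits_def minimals_def Field_Q)
  then have "circuits Q (poset_rank Q) (quot_rho rho) = orb ` circuits P card rho"
    using orb_circuit_iff sub by (auto simp: subset_iff image_iff; metis)
  moreover have "quot_poset G (simplex_act \<phi>) (Restr P (circuits P card rho)) =
      Restr Q (orb ` circuits P card rho)"
  proof (rule quot_poset_Restr[OF sub])
    show "Y \<in> circuits P card rho"
      if "X \<in> circuits P card rho" "Y \<in> C" "orb X = orb Y" for X Y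
      using that orb_circuit_iff[of X] orb_circuit_iff[of Y] sub by auto
  qed
  ultimately show ?thesis by simp
qed

section \<open>Comparison of the Tutte polynomials\<close>

lemma rho_le_over:
  assumes "X \<in> C" "Y \<in> C" "orbit G \<phi> ` X = orbit G \<phi> ` Y"
  shows "rho Y \<le> rho X"
proof (rule ccontr)
  assume "\<not> rho Y \<le> rho X"
  \<comment> \<open>(S5) would extend \<open>X\<close> by some \<open>y\<close> from
    \<open>Y\<close>. The vertex orbit of \<open>y\<close> already meets \<open>X\<close>, so
    translativity inside \<open>insert y X\<close> identifies \<open>y\<close> with a vertex of
    \<open>X\<close>.\<close>
  then obtain y where y: "y \<in> Y" "y \<notin> X" "insert y X \<in> C" using S5[of X Y] assms by auto
  then obtain x where x: "x \<in> X" "orbit G \<phi> x = orbit G \<phi> y" using assms(3) by (metis imageE imageI)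
  then obtain g where "g \<in> carrier G" "y = \<phi> g x"
    using vertex_orbit_eqE[of x y] in_vertices[OF assms(2) y(1)] by metis
  then have "y = x" using vertex_fixed[of "insert y X" x g] x y by simp
  then show False using x y by simp
qed

lemma rho_over_eq:
  assumes X: "X \<in> simplices_over G \<phi> C A"
  shows "rho_over G \<phi> C rho A = rho X"
proof -
  have "rho Y = rho X" if "Y \<in> simplices_over G \<phi> C A" for Y
  proof (rule antisym)
    have "X \<in> C" "Y \<in> C" "orbit G \<phi> ` X = orbit G \<phi> ` Y"
      using that X unfolding simplices_over_def by simp_all
    then show "rho Y \<le> rho X" "rho X \<le> rho Y" using rho_le_over by metis+
  qed
  then show ?thesis
    unfolding rho_over_def using X by (intro the_elem_image_unique) blast+
qed

text \<open>Two vertices of a simplex in the same vertex orbit coincide, so a simplex over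
  \<open>A\<close> has exactly one vertex in each element of \<open>A\<close>.\<close>

lemma card_over_eq:
  assumes "X \<in> simplices_over G \<phi> C A"
  shows "card A = card X"
proof -
  have X: "X \<in> C" "A = orbit G \<phi> ` X" using assms by (auto simp: simplices_over_def)
  have "inj_on (orbit G \<phi>) X"
  proof (rule inj_onI)
    fix a b assume ab: "a \<in> X" "b \<in> X" "orbit G \<phi> a = orbit G \<phi> b"
    then obtain g where "g \<in> carrier G" "b = \<phi> g a"
      using vertex_orbit_eqE[of a b] in_vertices[OF X(1)] by metis
    then show "a = b" using vertex_fixed[of X a g] X ab by simp
  qed
  then show ?thesis using X(2) card_image by blast
qed

lemma tutte_quotient:
  assumes cofin: "cofinite_action G \<phi> C" and mult: "finite_multiplicities G \<phi> C"
  shows "tutte_scheme Q (quot_rho rho) = tutte_action G \<phi> C rho"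
proof -
  define O' where "O' = orbits G (\<Union>C) \<phi>"
  define f where "f w = (varX - 1) ^ (total_rank Q (quot_rho rho) - quot_rho rho w) *
    (varY - 1) ^ (poset_rank Q w - quot_rho rho w)" for w
  define F where "F A = (varX - 1) ^ (total_rank P rho - rho_over G \<phi> C rho A) *
    (varY - 1) ^ (card A - rho_over G \<phi> C rho A)" for A :: "'a set set"
  \<comment> \<open>The summand is constant on each fibre, since rank and size are determined by
    \<open>A\<close>.\<close>
  have fF: "f w = F A" if w: "w \<in> orbits_over G \<phi> C A" for w A
  proof -
    obtain X where X: "X \<in> simplices_over G \<phi> C A" "w = orb X"
      using w by (auto simp: orbits_over_def orbits_def)
    then have "X \<in> C" by (simp add: simplices_over_def)
    then show ?thesis unfolding f_def F_def
      using X rho_over_eq card_over_eq poset_rank_Q quot_rho_orb total_rank_Q by simp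
  qed
  have "tutte_scheme Q (quot_rho rho) = (\<Sum>w\<in>Field Q. f w)"
    by (simp add: tutte_scheme_def f_def)
  also have "\<dots> = (\<Sum>A\<in>Pow O'. \<Sum>w\<in>orbits_over G \<phi> C A. f w)"
    unfolding Field_Q_orbits_over O'_def
    using cofin mult orbits_over_disjoint
    by (intro sum.UNION_disjoint) (auto simp: cofinite_action_def finite_multiplicities_def)
  \<comment> \<open>Each inner sum adds one constant \<open>mult G \<phi> C A\<close> times. Over an
    empty fibre both sides are 0, whatever the unspecified value of \<open>rho_over\<close>
    is.\<close>
  also have "\<dots> = (\<Sum>A\<in>Pow O'. of_nat (mult G \<phi> C A) * F A)"
    by (simp add: fF mult_def)
  also have "\<dots> = tutte_action G \<phi> C rho"
    by (simp add: tutte_action_def F_def O'_def mult.assoc)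
  finally show ?thesis .
qed

end

theorem theorem12p1:
  fixes C :: "'a set set" and rho :: "'a set \<Rightarrow> nat"
    and G :: "('g, 'm) monoid_scheme" and \<phi> :: "'g \<Rightarrow> 'a \<Rightarrow> 'a"
  assumes "semimatroid_action C rho G \<phi>"
    and "translative_action G \<phi> C"
    and "cofinite_action G \<phi> C"
    and "finite_multiplicities G \<phi> C"
  shows "let P = face_poset C;
             \<psi> = simplex_act \<phi>;
             Q = quot_poset G \<psi> P;
             rho_G = quot_rho rho
         in matroid_scheme Q rho_G
          \<and> Restr Q (flats Q rho_G) = quot_poset G \<psi> (Restr P (flats P rho))
          \<and> Restr Q (independents Q (poset_rank Q) rho_G)
              = quot_poset G \<psi> (Restr P (independents P card rho))
          \<and> Restr Q (circuits Q (poset_rank Q) rho_G)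
              = quot_poset G \<psi> (Restr P (circuits P card rho))
          \<and> tutte_scheme Q rho_G = tutte_action G \<phi> C rho"
proof -
  interpret translative_semimatroid_action C rho G \<phi>
    using assms(1,2)
    by (simp add: translative_semimatroid_action_def translative_semimatroid_action_axioms_def)
  show ?thesis
    unfolding Let_def
    using matroid_scheme_Q[OF finite_Field_Q[OF assms(3,4)]] flats_quotient
      independents_quotient circuits_quotient tutte_quotient[OF assms(3,4)]
    by blast
qed

end
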